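(* Let $\mu,\nu\ge0$, $\lambda>0$, $n\in\mathbb N_0$ and $x>0$. Then $${}_xI_\infty^{\mu,\lambda}\mathcal L_n^{(\nu,\lambda)}(x)=(2\lambda)^{-\mu}\,\mathcal L_n^{(\nu-\mu,\lambda)}(x)\qquad\text{if }\nu\ge\mu,$$ $${}_xD_\infty^{\mu,\lambda}\mathcal L_n^{(\nu,\lambda)}(x)=(2\lambda)^{\mu}\,\mathcal L_n^{(\mu+\nu,\lambda)}(x).$$
   Context: $\mathbb N_0=\{0,1,2,\dots\}$. For $\alpha>-1$, $L_n^{(\alpha)}$ is the Laguerre polynomial $L_n^{(\alpha)}(x)=\frac{(\alpha+1)_n}{n!}\,{}_1F_1(-n;\alpha+1;x)$. The generalized Laguerre functions (GLFs) are, for $\alpha\in\mathbb R$, $\lambda>0$, $x>0$, $n\in\mathbb N_0$, $$\mathcal L_n^{(\alpha,\lambda)}(x)=\begin{cases}x^{-\alpha}e^{-\lambda x}L_n^{(-\alpha)}(2\lambda x),&\alpha<0,\\ e^{-\lambda x}L_n^{(\alpha)}(2\lambda x),&\alpha\ge0.\end{cases}$$ For $\mu>0$, ${}_xI_\infty^{\mu}u(x)=\frac1{\Gamma(\mu)}\int_x^\infty (y-x)^{\mu-1}u(y)\,dy$, with ${}_xI_\infty^0$ the identity; for $\mu\in[k-1,k)$, $k\ge1$ an integer, ${}_xD_\infty^{\mu}u=(-1)^k\frac{d^k}{dx^k}\,{}_xI_\infty^{k-\mu}u$ (Riemann–Liouville). The right tempered fractional integral and derivative are ${}_xI_\infty^{\mu,\lambda}u=e^{\lambda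 x}\,{}_xI_\infty^{\mu}\{e^{-\lambda x}u\}$ and ${}_xD_\infty^{\mu,\lambda}u=e^{\lambda x}\,{}_xD_\infty^{\mu}\{e^{-\lambda x}u\}$. *)

theory Defs
  imports "HOL-Analysis.Analysis"
begin

definition hyp1F1 :: "real \<Rightarrow> real \<Rightarrow> real \<Rightarrow> real" where
  "hyp1F1 a b x = (\<Sum>k. pochhammer a k / pochhammer b k * (x ^ k / fact k))"

(* Only meant for \<alpha> > -1; the series then terminates at k = n with nonzero denominators. *)
definition laguerre :: "nat \<Rightarrow> real \<Rightarrow> real \<Rightarrow> real" where
  "laguerre n \<alpha> x = pochhammer (\<alpha> + 1) n / fact n * hyp1F1 (- real n) (\<alpha> + 1) x"

(* Only meant for x > 0. *)
definition GLF :: "nat \<Rightarrow> real \<Rightarrow> real \<Rightarrow> real \<Rightarrow> real" where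
  "GLF n \<alpha> lam x =
     (if \<alpha> < 0 then x powr (- \<alpha>) * exp (- lam * x) * laguerre n (- \<alpha>) (2 * lam * x)
      else exp (- lam * x) * laguerre n \<alpha> (2 * lam * x))"

definition right_frac_integral :: "real \<Rightarrow> (real \<Rightarrow> real) \<Rightarrow> real \<Rightarrow> real" where
  "right_frac_integral \<mu> u x =
     (if \<mu> = 0 then u x
      else 1 / Gamma \<mu> * (LINT y:{x<..}|lborel. (y - x) powr (\<mu> - 1) * u y))"

(* The Bochner integral is total and is 0 for non-integrable functions, so the
   convergence of the defining integral is recorded separately. *)
definition right_frac_integrable :: "real \<Rightarrow> (real \<Rightarrow> real) \<Rightarrow> real \<Rightarrow> bool" where
  "right_frac_integrable \<mu> u x \<longleftrightarrow>
     \<mu> = 0 \<or> set_integrable lborel {x<..} (\<lambda>y. (y - x) powr (\<mu> - 1) * u y)"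

(* The integer k \<ge> 1 with \<mu> \<in> [k - 1, k), for \<mu> \<ge> 0. *)
definition frac_order :: "real \<Rightarrow> nat" where
  "frac_order \<mu> = nat \<lfloor>\<mu>\<rfloor> + 1"

definition right_frac_deriv :: "real \<Rightarrow> (real \<Rightarrow> real) \<Rightarrow> real \<Rightarrow> real" where
  "right_frac_deriv \<mu> u x =
     (-1) ^ frac_order \<mu> *
     (deriv ^^ frac_order \<mu>) (right_frac_integral (real (frac_order \<mu>) - \<mu>) u) x"

(* deriv is total as well: this is the existence of the k-th derivative at x, which
   needs the lower derivatives in a neighbourhood of x. *)
primrec times_differentiable_at :: "nat \<Rightarrow> (real \<Rightarrow> real) \<Rightarrow> real \<Rightarrow> bool" where
  "times_differentiable_at 0 f x \<longleftrightarrow> True"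
| "times_differentiable_at (Suc k) f x \<longleftrightarrow>
     (\<forall>\<^sub>F y in nhds x. times_differentiable_at k f y) \<and>
     (deriv ^^ k) f field_differentiable (at x)"

definition right_frac_differentiable :: "real \<Rightarrow> (real \<Rightarrow> real) \<Rightarrow> real \<Rightarrow> bool" where
  "right_frac_differentiable \<mu> u x \<longleftrightarrow>
     (\<forall>\<^sub>F y in nhds x. right_frac_integrable (real (frac_order \<mu>) - \<mu>) u y) \<and>
     times_differentiable_at (frac_order \<mu>)
       (right_frac_integral (real (frac_order \<mu>) - \<mu>) u) x"

definition tempered_integral :: "real \<Rightarrow> real \<Rightarrow> (real \<Rightarrow> real) \<Rightarrow> real \<Rightarrow> real" where
  "tempered_integral \<mu> lam u x =
     exp (lam * x) * right_frac_integral \<mu> (\<lambda>y. exp (- lam * y) * u y) x"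

definition tempered_integrable :: "real \<Rightarrow> real \<Rightarrow> (real \<Rightarrow> real) \<Rightarrow> real \<Rightarrow> bool" where
  "tempered_integrable \<mu> lam u x \<longleftrightarrow>
     right_frac_integrable \<mu> (\<lambda>y. exp (- lam * y) * u y) x"

definition tempered_deriv :: "real \<Rightarrow> real \<Rightarrow> (real \<Rightarrow> real) \<Rightarrow> real \<Rightarrow> real" where
  "tempered_deriv \<mu> lam u x =
     exp (lam * x) * right_frac_deriv \<mu> (\<lambda>y. exp (- lam * y) * u y) x"

definition tempered_differentiable :: "real \<Rightarrow> real \<Rightarrow> (real \<Rightarrow> real) \<Rightarrow> real \<Rightarrow> bool" where
  "tempered_differentiable \<mu> lam u x \<longleftrightarrow>
     right_frac_differentiable \<mu> (\<lambda>y. exp (- lam * y) * u y) x"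

end

theory Submission imports Defs
begin

text \<open>
  For \<open>\<nu> \<ge> 0\<close> the weight \<open>exp (- lam * y)\<close> of the tempered operators turns the Laguerre function into
  \<open>f \<nu> y = exp (- b * y) * L n \<nu> (b * y)\<close> with \<open>b = 2 * lam\<close>, and on the family \<open>f a\<close> the untempered
  operators only move the parameter \<open>a\<close>: the fractional integral of order \<open>s\<close> sends \<open>f a\<close> to
  \<open>b powr (- s) * f (a - s)\<close>, and differentiation sends \<open>f a\<close> to \<open>- b * f (a + 1)\<close>. The theorem follows by
  composing them, since the fractional derivative of order \<open>\<mu>\<close> is a fractional integral of order
  \<open>k - \<mu>\<close> followed by \<open>k\<close> derivatives: the parameter moves by \<open>- (k - \<mu>) + k = \<mu>\<close>.

  The intermediate parameter \<open>\<nu> - (k - \<mu>)\<close> can be as small as \<open>-1\<close>, where the hypergeometric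
  formula breaks down. The argument therefore uses the Laguerre polynomial in a form with
  generalized binomial coefficients (\<open>laguerre_poly\<close>), which is polynomial in \<open>a\<close> and satisfies the
  same identities for every real \<open>a\<close>.

  The shift under integration (\<open>has_bochner_integral_Gamma_laguerre_poly\<close>) comes from expanding
  \<open>L n a (x + t)\<close> in powers of \<open>t\<close>. The coefficients are Laguerre polynomials with raised parameter, each
  power of \<open>t\<close> integrates to a value of the Gamma function, and the resulting sum is collapsed by
  Vandermonde's convolution. The shift under differentiation (\<open>exp_laguerre_poly_deriv\<close>) is Pascal's
  rule for the coefficients.
\<close>

section \<open>Laguerre polynomials with an arbitrary real parameter\<close>

definition laguerre_poly :: "nat \<Rightarrow> real \<Rightarrow> real \<Rightarrow> real" where
  "laguerre_poly n a x =
     (\<Sum>k\<le>n. (-1) ^ k / fact k * ((real n + a) gchoose (n - k)) * x ^ k)"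

lemma laguerre_eq_poly:
  assumes "a > -1"
  shows "laguerre n a x = laguerre_poly n a x"
proof -
  have "hyp1F1 (- real n) (a + 1) x =
      (\<Sum>k\<le>n. pochhammer (- real n) k / pochhammer (a + 1) k * (x ^ k / fact k))"
    unfolding hyp1F1_def
    by (rule suminf_finite) (auto simp: pochhammer_of_nat_eq_0_lemma not_le)
  then have "laguerre n a x =
      (\<Sum>k\<le>n. pochhammer (a + 1) n / fact n *
         (pochhammer (- real n) k / pochhammer (a + 1) k * (x ^ k / fact k)))"
    by (simp add: laguerre_def sum_distrib_left)
  also have "\<dots> = laguerre_poly n a x"
    unfolding laguerre_poly_def
  proof (rule sum.cong)
    fix k assume "k \<in> {..n}"
    then have kn: "k \<le> n" by simp
    have nz: "pochhammer (a + 1) k \<noteq> 0"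
      using assms pochhammer_pos[of "a + 1" k] by simp
    have quot: "pochhammer (a + 1) n = pochhammer (a + 1) k * pochhammer (a + 1 + real k) (n - k)"
      using kn by (rule pochhammer_product)
    have "pochhammer (- real n) k = (-1) ^ k * fact k * real (n choose k)"
      by (simp add: binomial_gbinomial gbinomial_pochhammer)
    also have "\<dots> = (-1) ^ k * fact n / fact (n - k)"
      using kn by (simp add: binomial_fact)
    finally have num: "pochhammer (- real n) k = (-1) ^ k * fact n / fact (n - k)" .
    have coeff: "(real n + a) gchoose (n - k) = pochhammer (a + 1 + real k) (n - k) / fact (n - k)"
      using kn by (simp add: gbinomial_pochhammer' algebra_simps)
    show "pochhammer (a + 1) n / fact n *
         (pochhammer (- real n) k / pochhammer (a + 1) k * (x ^ k / fact k)) =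
       (-1) ^ k / fact k * ((real n + a) gchoose (n - k)) * x ^ k"
      unfolding quot num coeff using nz by (simp add: field_simps)
  qed simp
  finally show ?thesis .
qed

text \<open>
  The coefficient of \<open>x ^ k\<close> involves \<open>real n + a\<close> only, and this number does not change when \<open>n\<close> is
  lowered and \<open>a\<close> raised by the same \<open>j\<close>. So after the binomial expansion of \<open>(x + t) ^ m\<close> the terms
  with a fixed power \<open>t ^ j\<close> form a Laguerre polynomial again.
\<close>

lemma laguerre_poly_Taylor:
  "laguerre_poly n a (x + t) =
     (\<Sum>j\<le>n. (- t) ^ j / fact j * laguerre_poly (n - j) (a + real j) x)"
proof -
  define g where "g j k = (- t) ^ j / fact j *
    ((-1) ^ k / fact k * ((real n + a) gchoose (n - j - k)) * x ^ k)" for j k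
  have "laguerre_poly n a (x + t) = (\<Sum>m\<le>n. \<Sum>j\<le>m. g j (m - j))"
    unfolding laguerre_poly_def
  proof (rule sum.cong)
    fix m assume "m \<in> {..n}"
    have "(x + t) ^ m = (\<Sum>j\<le>m. real (m choose j) * t ^ j * x ^ (m - j))"
      by (subst add.commute) (rule binomial_ring)
    then have "(-1) ^ m / fact m * ((real n + a) gchoose (n - m)) * (x + t) ^ m =
      (\<Sum>j\<le>m. (-1) ^ m / fact m * ((real n + a) gchoose (n - m)) *
         (real (m choose j) * t ^ j * x ^ (m - j)))"
      by (simp add: sum_distrib_left)
    also have "\<dots> = (\<Sum>j\<le>m. g j (m - j))"
    proof (rule sum.cong)
      fix j assume "j \<in> {..m}"
      then obtain k where m: "m = j + k"
        by (auto simp: le_iff_add)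
      show "(-1) ^ m / fact m * ((real n + a) gchoose (n - m)) *
         (real (m choose j) * t ^ j * x ^ (m - j)) = g j (m - j)"
        by (simp add: m g_def binomial_fact power_add power_minus[of t])
    qed simp
    finally show "(-1) ^ m / fact m * ((real n + a) gchoose (n - m)) * (x + t) ^ m =
      (\<Sum>j\<le>m. g j (m - j))" .
  qed simp
  also have "\<dots> = (\<Sum>(j, k)\<in>{(j, k). j + k \<le> n}. g j k)"
    by (rule sum.triangle_reindex_eq[symmetric])
  also have "{(j, k). j + k \<le> n} = Sigma {..n} (\<lambda>j. {..n - j})"
    by auto
  also have "(\<Sum>(j, k)\<in>Sigma {..n} (\<lambda>j. {..n - j}). g j k) = (\<Sum>j\<le>n. \<Sum>k\<le>n - j. g j k)"
    by (rule sum.Sigma[symmetric]) auto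
  also have "\<dots> = (\<Sum>j\<le>n. (- t) ^ j / fact j * laguerre_poly (n - j) (a + real j) x)"
    by (simp add: g_def laguerre_poly_def sum_distrib_left add.commute)
  finally show ?thesis .
qed

text \<open>
  Since \<open>(-1) ^ j * pochhammer s j / fact j\<close> is the generalized binomial coefficient of \<open>- s\<close> over \<open>j\<close>,
  comparing the coefficients of \<open>x ^ k\<close> leaves Vandermonde's convolution for \<open>- s\<close> and \<open>real n + a\<close>.
\<close>

lemma laguerre_poly_parameter_shift:
  "(\<Sum>j\<le>n. (-1) ^ j * pochhammer s j / fact j * laguerre_poly (n - j) (a + real j) x) =
     laguerre_poly n (a - s) x"
proof -
  define g where "g j k =
    (-1) ^ k / fact k * x ^ k * (((- s) gchoose j) * ((real n + a) gchoose (n - k - j)))" for j k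
  have "(\<Sum>j\<le>n. (-1) ^ j * pochhammer s j / fact j * laguerre_poly (n - j) (a + real j) x) =
      (\<Sum>j\<le>n. \<Sum>k\<le>n - j. g j k)"
    by (simp add: g_def laguerre_poly_def sum_distrib_left gbinomial_pochhammer algebra_simps)
  also have "\<dots> = (\<Sum>k\<le>n. \<Sum>j\<le>n - k. g j k)"
  proof -
    have "{k. k \<in> {..n} \<and> j + k \<le> n} = {..n - j}" if "j \<le> n" for j
      using that by auto
    moreover have "{j. j \<in> {..n} \<and> j + k \<le> n} = {..n - k}" if "k \<le> n" for k
      using that by auto
    ultimately show ?thesis
      using sum.swap_restrict[of "{..n}" "{..n}" g "\<lambda>j k. j + k \<le> n"] by simp
  qed
  also have "\<dots> = laguerre_poly n (a - s) x"
    unfolding laguerre_poly_def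
  proof (rule sum.cong)
    fix k assume "k \<in> {..n}"
    have "(\<Sum>j\<le>n - k. ((- s) gchoose j) * ((real n + a) gchoose (n - k - j))) =
        ((real n + (a - s)) gchoose (n - k))"
      using gbinomial_Vandermonde[of "- s" "real n + a" "n - k"]
      by (simp add: atMost_atLeast0 algebra_simps)
    then show "(\<Sum>j\<le>n - k. g j k) =
        (-1) ^ k / fact k * ((real n + (a - s)) gchoose (n - k)) * x ^ k"
      unfolding g_def sum_distrib_left[symmetric] by simp
  qed simp
  finally show ?thesis .
qed

section \<open>Derivatives\<close>

text \<open>
  The product rule leaves the polynomial identity \<open>L n a - (L n a)' = L n (a + 1)\<close>, which is Pascal's rule
  in each coefficient.
\<close>

lemma exp_laguerre_poly_deriv:
  "((\<lambda>x. exp (- (b * x)) * laguerre_poly n a (b * x)) has_field_derivative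
     (- b) * (exp (- (b * x)) * laguerre_poly n (a + 1) (b * x))) (at x)"
proof -
  define c where "c k = (-1) ^ k / fact k * ((real n + a) gchoose (n - k))" for k
  define p' where "p' y = (\<Sum>k\<le>n. c k * (real k * y ^ (k - 1)))" for y
  have p': "(laguerre_poly n a has_field_derivative p' y) (at y)" for y
    unfolding laguerre_poly_def[abs_def] p'_def c_def
    by (auto intro!: derivative_eq_intros sum.cong)
  have rec: "laguerre_poly n a y - p' y = laguerre_poly n (a + 1) y" for y
  proof -
    \<comment> \<open>The term of degree \<open>n\<close> is split off below, because Pascal's rule needs \<open>n - k\<close> to be a successor.\<close>
    have "p' y = (\<Sum>k<n. c (Suc k) * (real (Suc k) * y ^ k))"
      by (simp add: p'_def lessThan_Suc_atMost[symmetric] sum.lessThan_Suc_shift del: sum.lessThan_Suc)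
    also have "\<dots> = (\<Sum>k<n. - ((-1) ^ k / fact k * ((real n + a) gchoose (n - Suc k)) * y ^ k))"
      by (rule sum.cong) (simp_all add: c_def del: of_nat_Suc)
    finally have "laguerre_poly n a y - p' y =
        (\<Sum>k<n. (-1) ^ k / fact k * ((real n + a) gchoose (n - k)) * y ^ k) + (-1) ^ n / fact n * y ^ n
        + (\<Sum>k<n. (-1) ^ k / fact k * ((real n + a) gchoose (n - Suc k)) * y ^ k)"
      by (simp add: laguerre_poly_def lessThan_Suc_atMost[symmetric] sum_negf)
    also have "\<dots> = (\<Sum>k<n. (-1) ^ k / fact k * ((real n + (a + 1)) gchoose (n - k)) * y ^ k)
        + (-1) ^ n / fact n * y ^ n"
    proof -
      have "(-1) ^ k / fact k * ((real n + a) gchoose (n - k)) * y ^ k +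
          (-1) ^ k / fact k * ((real n + a) gchoose (n - Suc k)) * y ^ k =
          (-1) ^ k / fact k * ((real n + (a + 1)) gchoose (n - k)) * y ^ k" if "k < n" for k
      proof -
        have "((real n + a) + 1 gchoose Suc (n - Suc k)) =
            ((real n + a) gchoose (n - Suc k)) + ((real n + a) gchoose Suc (n - Suc k))"
          by (rule gbinomial_Suc_Suc)
        with that have "((real n + (a + 1)) gchoose (n - k)) =
            ((real n + a) gchoose (n - Suc k)) + ((real n + a) gchoose (n - k))"
          by (simp add: Suc_diff_Suc add.assoc)
        then show ?thesis
          by (simp only: ring_distribs add.commute)
      qed
      then show ?thesis
        by (simp add: sum.distrib[symmetric] add.assoc add.commute)
    qed
    also have "\<dots> = laguerre_poly n (a + 1) y"
      by (simp add: laguerre_poly_def lessThan_Suc_atMost[symmetric])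
    finally show ?thesis .
  qed
  show ?thesis
    unfolding rec[symmetric]
    by (rule derivative_eq_intros DERIV_chain2[OF p'] refl)+ (simp add: algebra_simps)
qed

lemma higher_deriv_exp_laguerre_poly:
  "(deriv ^^ k) (\<lambda>x. c * (exp (- (b * x)) * laguerre_poly n a (b * x))) =
     (\<lambda>x. (- b) ^ k * c * (exp (- (b * x)) * laguerre_poly n (a + real k) (b * x)))"
proof (induction k)
  case (Suc k)
  have "((\<lambda>x. (- b) ^ k * c * (exp (- (b * x)) * laguerre_poly n (a + real k) (b * x)))
      has_field_derivative
      (- b) ^ k * c * ((- b) * (exp (- (b * x)) * laguerre_poly n (a + real k + 1) (b * x)))) (at x)" for x
    by (intro DERIV_cmult exp_laguerre_poly_deriv)
  from DERIV_imp_deriv[OF this] show ?case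
    by (simp add: Suc.IH fun_eq_iff) (simp add: ac_simps)
qed simp

lemma times_differentiable_exp_laguerre_poly:
  "times_differentiable_at k (\<lambda>x. c * (exp (- (b * x)) * laguerre_poly n a (b * x))) x"
proof (induction k arbitrary: x)
  case (Suc k)
  have "(\<lambda>x. (- b) ^ k * c * (exp (- (b * x)) * laguerre_poly n (a + real k) (b * x)))
      field_differentiable (at x)"
    using DERIV_cmult[OF exp_laguerre_poly_deriv] unfolding field_differentiable_def by blast
  then show ?case
    by (simp add: Suc higher_deriv_exp_laguerre_poly)
qed simp

section \<open>Fractional integrals\<close>

lemma has_bochner_integral_Gamma:
  fixes s :: real
  assumes "s > 0"
  shows "has_bochner_integral lborel (\<lambda>t. indicator {0<..} t * (t powr (s - 1) * exp (- t))) (Gamma s)"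
proof (rule has_bochner_integral_nn_integral)
  have "indicator {0<..} t * (t powr (s - 1) * exp (- t)) =
      indicator {0..} t * t powr (s - 1) / exp t" for t :: real
    by (auto simp: indicator_def exp_minus field_simps)
  then show "(\<integral>\<^sup>+ t. ennreal (indicator {0<..} t * (t powr (s - 1) * exp (- t))) \<partial>lborel) = ennreal (Gamma s)"
    using Gamma_conv_nn_integral_real[OF assms] by simp
qed (use assms in \<open>auto intro: less_imp_le\<close>)

text \<open>
  Integrating the Taylor expansion in \<open>t\<close> termwise replaces \<open>t ^ j\<close> by
  \<open>Gamma (s + j) = Gamma s * pochhammer s j\<close>, and these are the weights that lower the parameter by \<open>s\<close> in
  \<open>laguerre_poly_parameter_shift\<close>.
\<close>

lemma has_bochner_integral_Gamma_laguerre_poly: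
  assumes "s > 0"
  shows "has_bochner_integral lborel
    (\<lambda>t. indicator {0<..} t * (t powr (s - 1) * exp (- t)) * laguerre_poly n a (x + t))
    (Gamma s * laguerre_poly n (a - s) x)"
proof -
  have "has_bochner_integral lborel
      (\<lambda>t. \<Sum>j\<le>n. (-1) ^ j / fact j * laguerre_poly (n - j) (a + real j) x *
         (indicator {0<..} t * (t powr (s + real j - 1) * exp (- t))))
      (\<Sum>j\<le>n. (-1) ^ j / fact j * laguerre_poly (n - j) (a + real j) x * Gamma (s + real j))"
    using assms
    by (intro has_bochner_integral_sum has_bochner_integral_mult_right has_bochner_integral_Gamma) auto
  also have "(\<lambda>t. \<Sum>j\<le>n. (-1) ^ j / fact j * laguerre_poly (n - j) (a + real j) x *
         (indicator {0<..} t * (t powr (s + real j - 1) * exp (- t)))) =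
      (\<lambda>t. indicator {0<..} t * (t powr (s - 1) * exp (- t)) * laguerre_poly n a (x + t))"
  proof
    fix t :: real
    have "t powr (s + real j - 1) = t powr (s - 1) * t ^ j" if "t > 0" for j
      using that by (simp add: powr_realpow[symmetric] powr_add[symmetric] algebra_simps)
    then show "(\<Sum>j\<le>n. (-1) ^ j / fact j * laguerre_poly (n - j) (a + real j) x *
         (indicator {0<..} t * (t powr (s + real j - 1) * exp (- t)))) =
      indicator {0<..} t * (t powr (s - 1) * exp (- t)) * laguerre_poly n a (x + t)"
      by (auto simp: laguerre_poly_Taylor sum_distrib_left indicator_def power_minus[of t]
          intro!: sum.cong)
  qed
  also have "(\<Sum>j\<le>n. (-1) ^ j / fact j * laguerre_poly (n - j) (a + real j) x * Gamma (s + real j)) =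
      Gamma s * laguerre_poly n (a - s) x"
  proof -
    have "s \<notin> \<int>\<^sub>\<le>\<^sub>0" using assms by (auto elim!: nonpos_Ints_cases)
    then have "Gamma (s + real j) = Gamma s * pochhammer s j" for j
      using assms by (simp add: pochhammer_Gamma field_simps Gamma_eq_zero_iff)
    then show ?thesis
      unfolding laguerre_poly_parameter_shift[where n = n and s = s and a = a and x = x, symmetric]
        sum_distrib_left
      by (simp add: algebra_simps)
  qed
  finally show ?thesis .
qed

text \<open>
  For \<open>s > 0\<close> the substitution \<open>t = b * (y - x)\<close> gives the preceding integral at \<open>b * x\<close>. The kernel
  contributes \<open>b powr (1 - s)\<close> and the measure \<open>1 / b\<close>, together \<open>b powr (- s)\<close>.
\<close>

lemma right_frac_integral_exp_laguerre_poly: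
  fixes s b a x :: real and n :: nat
  assumes "s \<ge> 0" and "b > 0"
  defines "u \<equiv> \<lambda>y. exp (- (b * y)) * laguerre_poly n a (b * y)"
  shows "right_frac_integrable s u x"
    and "right_frac_integral s u x = b powr (- s) * (exp (- (b * x)) * laguerre_poly n (a - s) (b * x))"
proof -
  have int: "has_bochner_integral lborel (\<lambda>y. indicator {x<..} y *\<^sub>R ((y - x) powr (s - 1) * u y))
      (Gamma s * (b powr (- s) * (exp (- (b * x)) * laguerre_poly n (a - s) (b * x))))" if "s > 0"
  proof -
    define h where "h t =
      indicator {0<..} t * (t powr (s - 1) * exp (- t)) * laguerre_poly n a (b * x + t)" for t
    have "has_bochner_integral lborel h (Gamma s * laguerre_poly n (a - s) (b * x))"
      unfolding h_def by (rule has_bochner_integral_Gamma_laguerre_poly[OF that])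
    then have "has_bochner_integral lborel (\<lambda>y. h (- (b * x) + b * y))
        ((Gamma s * laguerre_poly n (a - s) (b * x)) /\<^sub>R \<bar>b\<bar>)"
      using assms(2) by (subst (asm) lborel_has_bochner_integral_real_affine_iff[of b _ _ "- (b * x)"]) auto
    then have "has_bochner_integral lborel
        (\<lambda>y. b powr (1 - s) * exp (- (b * x)) * h (- (b * x) + b * y))
        (b powr (1 - s) * exp (- (b * x)) * ((Gamma s * laguerre_poly n (a - s) (b * x)) /\<^sub>R \<bar>b\<bar>))"
      by (rule has_bochner_integral_mult_right)
    also have "(\<lambda>y. b powr (1 - s) * exp (- (b * x)) * h (- (b * x) + b * y)) =
        (\<lambda>y. indicator {x<..} y *\<^sub>R ((y - x) powr (s - 1) * u y))"
    proof
      fix y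
      show "b powr (1 - s) * exp (- (b * x)) * h (- (b * x) + b * y) =
          indicator {x<..} y *\<^sub>R ((y - x) powr (s - 1) * u y)"
      proof (cases "x < y")
        case True
        have scale: "(- (b * x) + b * y) powr (s - 1) = b powr (s - 1) * (y - x) powr (s - 1)"
          using True assms(2) by (simp add: powr_mult[symmetric] algebra_simps)
        have cancel: "b powr (1 - s) * b powr (s - 1) = 1"
          using assms(2) by (simp add: powr_add[symmetric])
        have expo: "exp (- (b * x)) * exp (- (- (b * x) + b * y)) = exp (- (b * y))"
          by (simp add: exp_add[symmetric])
        have ind: "indicator {0<..} (- (b * x) + b * y) = (1::real)"
          using True assms(2) by (simp add: indicator_def)
        have "b powr (1 - s) * exp (- (b * x)) * h (- (b * x) + b * y) =
            (b powr (1 - s) * b powr (s - 1)) * (y - x) powr (s - 1) *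
            (exp (- (b * x)) * exp (- (- (b * x) + b * y))) * laguerre_poly n a (b * y)"
          unfolding h_def scale ind by simp
        also have "\<dots> = (y - x) powr (s - 1) * u y"
          unfolding cancel expo u_def by simp
        finally show ?thesis
          using True by simp
      qed (use assms(2) in \<open>auto simp: h_def indicator_def\<close>)
    qed
    also have "b powr (1 - s) * exp (- (b * x)) * ((Gamma s * laguerre_poly n (a - s) (b * x)) /\<^sub>R \<bar>b\<bar>) =
        Gamma s * (b powr (- s) * (exp (- (b * x)) * laguerre_poly n (a - s) (b * x)))"
      using assms(2) by (simp add: powr_diff powr_minus field_simps)
    finally show ?thesis .
  qed
  show "right_frac_integrable s u x"
    using integrable.intros[OF int] assms(1)
    by (cases "s = 0") (simp_all add: right_frac_integrable_def set_integrable_def)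
  show "right_frac_integral s u x = b powr (- s) * (exp (- (b * x)) * laguerre_poly n (a - s) (b * x))"
  proof (cases "s = 0")
    case True
    then show ?thesis using assms(2) by (simp add: right_frac_integral_def u_def)
  next
    case False
    then have "s > 0" using assms(1) by simp
    then have "Gamma s \<noteq> 0" using Gamma_real_pos[of s] by linarith
    with has_bochner_integral_integral_eq[OF int[OF \<open>s > 0\<close>]] False show ?thesis
      by (simp add: right_frac_integral_def set_lebesgue_integral_def)
  qed
qed

section \<open>Tempered integrals and derivatives of Laguerre functions\<close>

lemma exp_GLF_eq:
  assumes "a \<ge> 0"
  shows "exp (- lam * y) * GLF n a lam y = exp (- (2 * lam * y)) * laguerre_poly n a (2 * lam * y)"
  using assms by (simp add: GLF_def laguerre_eq_poly exp_add[symmetric] mult.assoc[symmetric])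

lemma exp_mult_exp_laguerre_poly_eq_GLF:
  assumes "a \<ge> 0"
  shows "exp (lam * x) * (exp (- (2 * lam * x)) * laguerre_poly n a (2 * lam * x)) = GLF n a lam x"
  unfolding exp_GLF_eq[OF assms, symmetric] by (simp add: mult.assoc[symmetric] flip: exp_add)

theorem lemma2:
  fixes \<mu> \<nu> lam x :: real and n :: nat
  assumes "\<mu> \<ge> 0" and "\<nu> \<ge> 0" and "lam > 0" and "x > 0"
  shows "(\<nu> \<ge> \<mu> \<longrightarrow>
            tempered_integrable \<mu> lam (GLF n \<nu> lam) x \<and>
            tempered_integral \<mu> lam (GLF n \<nu> lam) x
              = (2 * lam) powr (- \<mu>) * GLF n (\<nu> - \<mu>) lam x) \<and>
         tempered_differentiable \<mu> lam (GLF n \<nu> lam) x \<and>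
         tempered_deriv \<mu> lam (GLF n \<nu> lam) x
           = (2 * lam) powr \<mu> * GLF n (\<mu> + \<nu>) lam x"
proof -
  define b where "b = 2 * lam"
  define f where "f a y = exp (- (b * y)) * laguerre_poly n a (b * y)" for a y
  have b: "b > 0" using assms(3) by (simp add: b_def)
  have weight: "(\<lambda>y. exp (- lam * y) * GLF n \<nu> lam y) = f \<nu>"
    using exp_GLF_eq[OF assms(2)] by (simp add: fun_eq_iff f_def b_def)
  have unweight: "exp (lam * x) * f a x = GLF n a lam x" if "a \<ge> 0" for a
    using exp_mult_exp_laguerre_poly_eq_GLF[OF that] by (simp add: f_def b_def)
  have integrable: "right_frac_integrable s (f \<nu>) y"
    and integral: "right_frac_integral s (f \<nu>) y = b powr (- s) * f (\<nu> - s) y" if "s \<ge> 0" for s y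
    using right_frac_integral_exp_laguerre_poly[OF that b] by (simp_all add: f_def[abs_def])

  have "tempered_integrable \<mu> lam (GLF n \<nu> lam) x"
    by (simp only: tempered_integrable_def weight integrable[OF assms(1)])
  moreover have "tempered_integral \<mu> lam (GLF n \<nu> lam) x = b powr (- \<mu>) * GLF n (\<nu> - \<mu>) lam x"
    if "\<nu> \<ge> \<mu>"
    unfolding tempered_integral_def weight integral[OF assms(1)]
    using unweight[of "\<nu> - \<mu>"] that by simp

  moreover define k where "k = frac_order \<mu>"
  define s where "s = real k - \<mu>"
  have s: "s \<ge> 0"
    unfolding s_def k_def frac_order_def using assms(1) by linarith
  \<comment> \<open>The equation holds at every real point, so it can be differentiated \<open>k\<close> times by rewriting.\<close>
  have integral_fun: "right_frac_integral s (f \<nu>) = (\<lambda>y. b powr (- s) * f (\<nu> - s) y)"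
    by (rule ext) (rule integral[OF s])
  have "tempered_differentiable \<mu> lam (GLF n \<nu> lam) x"
    unfolding tempered_differentiable_def right_frac_differentiable_def weight
      k_def[symmetric] s_def[symmetric] integral_fun
    using times_differentiable_exp_laguerre_poly integrable[OF s]
    by (auto simp: f_def[abs_def] intro!: always_eventually)
  moreover have "tempered_deriv \<mu> lam (GLF n \<nu> lam) x = b powr \<mu> * GLF n (\<mu> + \<nu>) lam x"
  proof -
    have "right_frac_deriv \<mu> (f \<nu>) x = (-1) ^ k * ((- b) ^ k * b powr (- s) * f (\<nu> - s + real k) x)"
      unfolding right_frac_deriv_def k_def[symmetric] s_def[symmetric] integral_fun
      by (simp add: f_def higher_deriv_exp_laguerre_poly)
    also have "\<dots> = b ^ k * b powr (- s) * f (\<mu> + \<nu>) x"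
    proof -
      have "\<nu> - s + real k = \<mu> + \<nu>"
        by (simp add: s_def)
      moreover have "(-1) ^ k * (- b) ^ k = b ^ k"
        unfolding power_mult_distrib[symmetric] by simp
      ultimately show ?thesis
        by (simp only: mult.assoc[symmetric])
    qed
    also have "b ^ k * b powr (- s) = b powr \<mu>"
      using b by (simp add: s_def flip: powr_realpow powr_add)
    finally have "tempered_deriv \<mu> lam (GLF n \<nu> lam) x = b powr \<mu> * (exp (lam * x) * f (\<mu> + \<nu>) x)"
      unfolding tempered_deriv_def weight by simp
    then show ?thesis
      using unweight[of "\<mu> + \<nu>"] assms(1,2) by simp
  qed
  ultimately show ?thesis
    by (simp add: b_def)
qed

end
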